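(* Let $P\in\mathbb{Z}[x]$ be a monic polynomial of degree $d$ without multiple roots, with roots ordered as $\alpha_1,\dots,\alpha_d$ so that $|\alpha_1|\ge|\alpha_2|\ge\dots\ge|\alpha_d|$. Then $$\limsup_{n\to\infty}|\Delta(P_n)|^{\frac1n}=\prod_{j=1}^d|\alpha_j|^{2(d-j)}.$$
   Context: For $n\ge1$, $P_n(x):=\prod_{j=1}^d(x-\alpha_j^n)\in\mathbb{Z}[x]$ and $\Delta(P_n)=\prod_{1\le j<k\le d}(\alpha_j^n-\alpha_k^n)^2$ is its discriminant. *)

theory Defs
  imports "HOL-Analysis.Analysis" "HOL-Computational_Algebra.Computational_Algebra"
begin

text \<open>
  Root systems are families indexed by \<open>1, \<dots>, d\<close>, listing each root with its multiplicity;
  the values of the family outside \<open>{1..d}\<close> are irrelevant.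
\<close>

definition roots_family :: "complex poly \<Rightarrow> (nat \<Rightarrow> complex) \<Rightarrow> bool" where
  "roots_family p r \<longleftrightarrow> p = smult (lead_coeff p) (\<Prod>j=1..degree p. [:- r j, 1:])"

text \<open>
  The discriminant of a complex polynomial \<open>p\<close> of degree \<open>m\<close> with leading coefficient \<open>c\<close> and
  roots \<open>r 1, \<dots>, r m\<close> is \<open>c\<^sup>2\<^sup>m\<^sup>-\<^sup>2 \<Prod>j<k. (r j - r k)\<^sup>2\<close>. By the lemma \<open>discriminant_eq\<close> below it
  does not depend on the chosen enumeration of the roots.
\<close>

definition discriminant :: "complex poly \<Rightarrow> complex" where
  "discriminant p =
     (let r = (SOME r. roots_family p r) in
        lead_coeff p ^ (2 * degree p - 2) *
        (\<Prod>k=1..degree p. \<Prod>j=1..<k. (r j - r k)\<^sup>2))"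

text \<open>The polynomial \<open>P\<^sub>n\<close>, whose roots are the \<open>n\<close>-th powers of \<open>\<alpha> 1, \<dots>, \<alpha> d\<close>.\<close>

definition power_poly :: "nat \<Rightarrow> (nat \<Rightarrow> complex) \<Rightarrow> nat \<Rightarrow> complex poly" where
  "power_poly d \<alpha> n = (\<Prod>j=1..d. [:- (\<alpha> j ^ n), 1:])"

lemma poly_prod_linear_factors_mset:
  fixes r s :: "nat \<Rightarrow> complex"
  assumes "finite A" "finite B"
    and "(\<Prod>j\<in>A. [:- r j, 1:]) = (\<Prod>j\<in>B. [:- s j, 1:])"
  shows "image_mset r (mset_set A) = image_mset s (mset_set B)"
proof -
  have ord: "order x (\<Prod>j\<in>A. [:- r j, 1:]) = count (image_mset r (mset_set A)) x"
    if "finite A" for A and r :: "nat \<Rightarrow> complex" and x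
    using that
  proof (induction A rule: finite_induct)
    case (insert a A)
    have "(\<Prod>j\<in>insert a A. [:- r j, 1:]) \<noteq> 0"
      using insert.hyps by (subst prod_zero_iff) auto
    then have "order x (\<Prod>j\<in>insert a A. [:- r j, 1:])
        = order x [:- r a, 1:] + order x (\<Prod>j\<in>A. [:- r j, 1:])"
      using insert.hyps by (simp add: order_mult del: mult_pCons_left)
    moreover have "order x [:- r a, 1:] = (if x = r a then 1 else 0)"
      using order_power_n_n[of "r a" 1] by (auto intro: order_0I)
    ultimately show ?case
      using insert by simp
  qed (simp add: order_0I)
  show ?thesis
    by (intro multiset_eqI) (simp only: ord[OF assms(1), symmetric] ord[OF assms(2), symmetric] assms(3))
qed

lemma prod_diff_squares_eq:
  fixes r :: "nat \<Rightarrow> complex"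
  shows "(\<Prod>k=1..m. \<Prod>j=1..<k. (r j - r k)\<^sup>2) =
     (\<Prod>k=1..m. (-1) ^ (k - 1)) * (\<Prod>k\<in>{1..m}. \<Prod>j\<in>{1..m} - {k}. r j - r k)"
proof (induction m)
  case (Suc m)
  have split: "{1..Suc m} = insert (Suc m) {1..m}" by auto
  have a: "{1..Suc m} - {k} = insert (Suc m) ({1..m} - {k})" if "k \<in> {1..m}" for k
    using that by auto
  have b: "{1..Suc m} - {Suc m} = {1..m}" by auto
  have "(\<Prod>k\<in>{1..Suc m}. \<Prod>j\<in>{1..Suc m} - {k}. r j - r k)
      = (\<Prod>j\<in>{1..m}. r j - r (Suc m)) *
        (\<Prod>k\<in>{1..m}. \<Prod>j\<in>{1..Suc m} - {k}. r j - r k)"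
    by (subst (1) split, subst prod.insert) (use b in \<open>simp_all add: split[symmetric] del: One_nat_def\<close>)
  also have "(\<Prod>k\<in>{1..m}. \<Prod>j\<in>{1..Suc m} - {k}. r j - r k)
      = (\<Prod>k\<in>{1..m}. (r (Suc m) - r k) * (\<Prod>j\<in>{1..m} - {k}. r j - r k))"
    by (intro prod.cong refl, subst a, assumption, subst prod.insert) simp_all
  also have "\<dots> = (\<Prod>k\<in>{1..m}. (-1) * (r k - r (Suc m))) *
       (\<Prod>k\<in>{1..m}. \<Prod>j\<in>{1..m} - {k}. r j - r k)"
    by (simp add: prod.distrib)
  also have "(\<Prod>k\<in>{1..m}. (-1) * (r k - r (Suc m))) = (-1) ^ m * (\<Prod>k\<in>{1..m}. r k - r (Suc m))"
    by (subst prod.distrib) simp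
  finally have c: "(\<Prod>k\<in>{1..Suc m}. \<Prod>j\<in>{1..Suc m} - {k}. r j - r k)
      = (-1) ^ m * (\<Prod>k\<in>{1..m}. r k - r (Suc m))\<^sup>2 *
        (\<Prod>k\<in>{1..m}. \<Prod>j\<in>{1..m} - {k}. r j - r k)"
    by (simp add: power2_eq_square mult_ac)
  have sq: "(-1) ^ m * ((-1) ^ m :: complex) = 1"
    by (simp flip: power_mult_distrib)
  have L: "(\<Prod>k=1..Suc m. \<Prod>j=1..<k. (r j - r k)\<^sup>2) =
      (\<Prod>k=1..m. \<Prod>j=1..<k. (r j - r k)\<^sup>2) * (\<Prod>k\<in>{1..m}. r k - r (Suc m))\<^sup>2"
    by (simp add: prod_power_distrib atLeastLessThanSuc_atLeastAtMost)
  have S: "(\<Prod>k=1..Suc m. (-1 :: complex) ^ (k - 1)) = (\<Prod>k=1..m. (-1) ^ (k - 1)) * (-1) ^ m"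
    by simp
  have e: "(x * e) * y = (x * u) * (u * y * e)" if "u * u = 1" for x y e u :: complex
  proof -
    have "(x * u) * (u * y * e) = (u * u) * ((x * e) * y)" by (simp only: mult_ac)
    then show ?thesis using that by simp
  qed
  show ?case
    unfolding L S c Suc.IH by (rule e[OF sq])
qed simp

lemma prod_diff_squares_cong:
  fixes r s :: "nat \<Rightarrow> complex"
  assumes "image_mset r (mset_set {1..m}) = image_mset s (mset_set {1..m})"
  shows "(\<Prod>k=1..m. \<Prod>j=1..<k. (r j - r k)\<^sup>2) = (\<Prod>k=1..m. \<Prod>j=1..<k. (s j - s k)\<^sup>2)"
proof -
  from image_mset_eq_implies_permutes[OF finite_atLeastAtMost assms[symmetric]]
  obtain f where f: "f permutes {1..m}" and rs: "\<And>x. x \<in> {1..m} \<Longrightarrow> s x = r (f x)"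
    by metis
  have inj: "inj f" and img: "f ` {1..m} = {1..m}"
    using f by (auto simp: permutes_inj permutes_image)
  have "(\<Prod>k\<in>{1..m}. \<Prod>j\<in>{1..m} - {k}. s j - s k)
      = (\<Prod>k\<in>{1..m}. \<Prod>j\<in>{1..m} - {k}. r (f j) - r (f k))"
    by (intro prod.cong refl) (auto simp: rs)
  also have "\<dots> = (\<Prod>k\<in>{1..m}. \<Prod>j\<in>{1..m} - {f k}. r j - r (f k))"
  proof (rule prod.cong[OF refl])
    fix k
    have "f ` ({1..m} - {k}) = {1..m} - {f k}"
      using inj img by (simp add: image_set_diff)
    then show "(\<Prod>j\<in>{1..m} - {k}. r (f j) - r (f k)) = (\<Prod>j\<in>{1..m} - {f k}. r j - r (f k))"
      using prod.reindex[of f "{1..m} - {k}" "\<lambda>j. r j - r (f k)"] inj_on_subset[OF inj]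
      by simp
  qed
  also have "\<dots> = (\<Prod>k\<in>{1..m}. \<Prod>j\<in>{1..m} - {k}. r j - r k)"
    using prod.permute[OF f, of "\<lambda>k. \<Prod>j\<in>{1..m} - {k}. r j - r k"] by (simp add: comp_def)
  finally show ?thesis
    by (simp only: prod_diff_squares_eq)
qed

lemma discriminant_eq:
  assumes "p \<noteq> 0" "roots_family p r"
  shows "discriminant p = lead_coeff p ^ (2 * degree p - 2) *
           (\<Prod>k=1..degree p. \<Prod>j=1..<k. (r j - r k)\<^sup>2)"
proof -
  define s where "s = (SOME r. roots_family p r)"
  have s: "roots_family p s"
    unfolding s_def using assms(2) by (rule someI[of "roots_family p"])
  have "smult (lead_coeff p) (\<Prod>j=1..degree p. [:- s j, 1:])
      = smult (lead_coeff p) (\<Prod>j=1..degree p. [:- r j, 1:])"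
    using s assms(2) unfolding roots_family_def by metis
  then have "(\<Prod>j=1..degree p. [:- s j, 1:]) = (\<Prod>j=1..degree p. [:- r j, 1:])"
    using assms(1) by (metis leading_coeff_0_iff smult_cancel)
  then have "image_mset s (mset_set {1..degree p}) = image_mset r (mset_set {1..degree p})"
    by (intro poly_prod_linear_factors_mset) auto
  from prod_diff_squares_cong[OF this] show ?thesis
    by (simp add: discriminant_def s_def[symmetric] Let_def)
qed

lemma degree_power_poly: "degree (power_poly d \<alpha> n) = d"
  unfolding power_poly_def by (subst degree_prod_eq_sum_degree) auto

lemma lead_coeff_power_poly: "lead_coeff (power_poly d \<alpha> n) = 1"
  unfolding power_poly_def by (subst lead_coeff_prod) auto

lemma discriminant_power_poly:
  "discriminant (power_poly d \<alpha> n) = (\<Prod>k=1..d. \<Prod>j=1..<k. (\<alpha> j ^ n - \<alpha> k ^ n)\<^sup>2)"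
proof -
  have "roots_family (power_poly d \<alpha> n) (\<lambda>j. \<alpha> j ^ n)"
    unfolding roots_family_def degree_power_poly lead_coeff_power_poly[simplified degree_power_poly]
    by (simp add: power_poly_def)
  moreover have "power_poly d \<alpha> n \<noteq> 0"
    using lead_coeff_power_poly[of d \<alpha> n] by auto
  ultimately show ?thesis
    using discriminant_eq[of "power_poly d \<alpha> n" "\<lambda>j. \<alpha> j ^ n"] lead_coeff_power_poly[of d \<alpha> n]
    by (simp add: degree_power_poly)
qed

end

theory Submission
  imports Defs
begin

text \<open>
  For \<open>j < k\<close> write \<open>z = \<alpha>\<^sub>k / \<alpha>\<^sub>j\<close>, so that \<open>|z| \<le> 1\<close> and \<open>z \<noteq> 1\<close>; then
  \<open>|\<Delta>(P\<^sub>n)|\<close> is the \<open>n\<close>-th power of the claimed value times \<open>\<Prod> |1 - z\<^sup>n|\<^sup>2\<close>. The latter product is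
  bounded, so only a lower bound for infinitely many \<open>n\<close> is needed. By compactness there are
  arbitrarily large \<open>m\<close> for which \<open>z\<^sup>m\<close> is close to \<open>1\<close> for all the \<open>z\<close> of modulus \<open>1\<close> at once, and
  then \<open>n = m + 1\<close> has \<open>z\<^sup>n\<close> close to \<open>z \<noteq> 1\<close>.
\<close>

text \<open>Each new index refines the subsequence found so far; convergence for the earlier indices
  survives passing to a further subsequence.\<close>

lemma finite_common_convergent_subseq:
  fixes f :: "'a \<Rightarrow> nat \<Rightarrow> 'b::heine_borel"
  assumes "finite Z" "\<And>z. z \<in> Z \<Longrightarrow> bounded (range (f z))"
  shows "\<exists>r. strict_mono (r :: nat \<Rightarrow> nat) \<and> (\<forall>z\<in>Z. convergent (f z \<circ> r))"
  using assms
proof (induction Z rule: finite_induct)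
  case empty
  show ?case using strict_mono_id by auto
next
  case (insert w Z)
  then obtain r where r: "strict_mono r" "\<forall>z\<in>Z. convergent (f z \<circ> r)"
    by blast
  have "bounded (range (f w \<circ> r))"
    by (rule bounded_subset[OF insert.prems[of w]]) auto
  from bounded_imp_convergent_subsequence[OF this]
  obtain l s where s: "strict_mono s" "((f w \<circ> r) \<circ> s) \<longlonglongrightarrow> l"
    by blast
  have "convergent (f z \<circ> (r \<circ> s))" if "z \<in> insert w Z" for z
    using that r(2) s convergent_subseq_convergent[of "f z \<circ> r" s]
    by (auto simp: comp_assoc convergent_def)
  with strict_mono_o[OF r(1) s(1)] show ?case by blast
qed

text \<open>Along a common convergent subsequence \<open>r\<close> the powers are Cauchy. Since
  \<open>z\<close> has norm 1, cancelling \<open>z ^ r k\<close> from a small difference of two such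
  powers leaves a power with exponent the gap in \<open>r\<close>, close to 1.\<close>

lemma simultaneous_powers_near_1:
  fixes Z :: "'a::{real_normed_div_algebra,heine_borel} set"
  assumes "finite Z" "\<And>z. z \<in> Z \<Longrightarrow> norm z = 1" "e > 0"
  shows "\<exists>\<^sub>F n in sequentially. \<forall>z\<in>Z. norm (z ^ n - 1) < e"
  unfolding frequently_sequentially
proof
  fix N
  have "bounded (range (\<lambda>n. z ^ n))" if "z \<in> Z" for z
    using assms(2)[OF that] by (intro boundedI[where B=1]) (auto simp: norm_power)
  from finite_common_convergent_subseq[OF assms(1), of "(^)", OF this]
  obtain r where r: "strict_mono (r :: nat \<Rightarrow> nat)" "\<forall>z\<in>Z. convergent ((\<lambda>n. z ^ n) \<circ> r)"
    by blast
  have "\<forall>z\<in>Z. \<exists>K. \<forall>m\<ge>K. \<forall>n\<ge>K. norm (z ^ r m - z ^ r n) < e"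
    using r(2) CauchyD[OF convergent_Cauchy assms(3)] by (metis comp_apply)
  then obtain K where K: "\<And>z m n. z \<in> Z \<Longrightarrow> m \<ge> K z \<Longrightarrow> n \<ge> K z \<Longrightarrow> norm (z ^ r m - z ^ r n) < e"
    by metis
  \<comment> \<open>One threshold for all of \<open>Z\<close>; the 0 covers empty
    \<open>Z\<close>.\<close>
  define k where "k = Max (insert 0 (K ` Z))"
  have k: "K z \<le> k" if "z \<in> Z" for z
    unfolding k_def using that assms(1) by (intro Max_ge) auto
  \<comment> \<open>A strictly increasing \<open>r\<close> gains at least 1 per step, so going
    \<open>N\<close> steps beyond \<open>k\<close> makes the gap \<open>n\<close> at least
    \<open>N\<close>.\<close>
  have mono: "r k + N \<le> r (k + N)"
    using r(1) by (induction N) (auto simp: strict_mono_Suc_iff Suc_le_eq intro: le_less_trans)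
  define n where "n = r (k + N) - r k"
  have rn: "r (k + N) = r k + n"
    using mono by (simp add: n_def)
  have "norm (z ^ n - 1) < e" if z: "z \<in> Z" for z
  proof -
    have "norm (z ^ n - 1) = norm (z ^ r k * (z ^ n - 1))"
      using assms(2)[OF z] by (simp add: norm_mult norm_power)
    also have "\<dots> = norm (z ^ r (k + N) - z ^ r k)"
      by (simp only: rn power_add right_diff_distrib mult_1_right)
    also have "\<dots> < e"
      using k[OF z] by (intro K z) auto
    finally show ?thesis .
  qed
  with mono show "\<exists>n\<ge>N. \<forall>z\<in>Z. norm (z ^ n - 1) < e"
    by (intro exI[of _ n]) (auto simp: n_def)
qed

text \<open>Inside the unit disc every positive exponent works, as powers only shrink. Hence the
  exponents can be chosen for the points of modulus 1 alone.\<close>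

lemma simultaneous_powers_away_from_1:
  fixes Z :: "'a::{real_normed_field,heine_borel} set"
  assumes "finite Z" "\<And>z. z \<in> Z \<Longrightarrow> norm z \<le> 1" "1 \<notin> Z"
  shows "\<exists>c>0. \<exists>\<^sub>F n in sequentially. \<forall>z\<in>Z. c \<le> norm (1 - z ^ n)"
proof -
  \<comment> \<open>On the unit circle half the distance to 1 is reserved for the error in
    \<open>z ^ n\<close> being near 1; the other half remains as the bound.\<close>
  define \<delta> where "\<delta> z = (if norm z = 1 then norm (1 - z) / 2 else 1 - norm z)" for z :: 'a
  define c where "c = Min (insert 1 (\<delta> ` Z))"
  have "0 < \<delta> z" if "z \<in> Z" for z
    using that assms(2)[OF that] assms(3) by (auto simp: \<delta>_def)
  then have c: "c > 0"
    unfolding c_def using assms(1) by (subst Min_gr_iff) auto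
  have c_le: "c \<le> \<delta> z" if "z \<in> Z" for z
    unfolding c_def using that assms(1) by (intro Min_le) auto
  define U where "U = {z \<in> Z. norm z = 1}"
  have "\<exists>\<^sub>F n in sequentially. \<forall>z\<in>U. norm (z ^ n - 1) < c"
    using assms(1) c by (intro simultaneous_powers_near_1) (auto simp: U_def)
  then have "\<exists>\<^sub>F n in sequentially. \<forall>z\<in>Z. c \<le> norm (1 - z ^ n)"
    unfolding frequently_sequentially
  proof (intro allI)
    fix N
    assume "\<forall>N. \<exists>n\<ge>N. \<forall>z\<in>U. norm (z ^ n - 1) < c"
    then obtain n where n: "n \<ge> N" "\<forall>z\<in>U. norm (z ^ n - 1) < c" by blast
    have "c \<le> norm (1 - z ^ Suc n)" if z: "z \<in> Z" for z
    proof (cases "norm z = 1")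
      case True
      \<comment> \<open>Triangle inequality for 1 - z = (1 - \<open>z ^ Suc n\<close>) + z
        (\<open>z ^ n\<close> - 1).\<close>
      have "norm (1 - z) \<le> norm (1 - z ^ Suc n) + norm (z * (z ^ n - 1))"
        by (rule order_trans[OF _ norm_triangle_ineq]) (simp add: algebra_simps)
      moreover have "norm (z * (z ^ n - 1)) < c"
        using n(2) z True by (simp add: U_def norm_mult)
      moreover have "2 * c \<le> norm (1 - z)"
        using c_le[OF z] True by (simp add: \<delta>_def)
      ultimately show ?thesis by linarith
    next
      case False
      have "norm z ^ Suc n \<le> norm z"
        using assms(2)[OF z] by (simp add: mult_left_le power_le_one)
      moreover have "1 - norm z ^ Suc n \<le> norm (1 - z ^ Suc n)"
        by (metis norm_one norm_power norm_triangle_ineq2)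
      ultimately show ?thesis
        using c_le[OF z] False by (simp add: \<delta>_def)
    qed
    with n(1) show "\<exists>n\<ge>N. \<forall>z\<in>Z. c \<le> norm (1 - z ^ n)"
      by (intro exI[of _ "Suc n"]) auto
  qed
  with c show ?thesis by blast
qed

text \<open>The n-th root of a positive constant tends to 1, so the bounds \<open>C\<close> and
  \<open>c\<close> on \<open>W\<close> disappear in the limit. A lower bound for infinitely many
  \<open>n\<close> suffices for a limsup.\<close>

lemma limsup_root_power_times:
  fixes W :: "nat \<Rightarrow> real"
  assumes "B \<ge> 0" "\<And>n. W n \<le> C" "c > 0" "\<exists>\<^sub>F n in sequentially. c \<le> W n"
  shows "limsup (\<lambda>n. ereal (root n (B ^ n * W n))) = ereal B"
proof (rule antisym)
  \<comment> \<open>Index 0 is excluded because \<open>root 0\<close> is constantly 0.\<close>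
  have root_eq: "root n (B ^ n * x) = B * root n x" if "n > 0" for n x
    using assms(1) that by (simp add: real_root_mult real_root_power_cancel)
  have lim: "(\<lambda>n. ereal (B * root n x)) \<longlonglongrightarrow> ereal B" if "x > 0" for x
    using tendsto_mult[OF tendsto_const[of B] LIMSEQ_root_const[OF that]] by simp
  have "C > 0"
    using frequently_ex[OF assms(4)] assms(2,3) by (meson less_le_trans)
  have "limsup (\<lambda>n. ereal (root n (B ^ n * W n))) \<le> limsup (\<lambda>n. ereal (B * root n C))"
  proof (rule Limsup_mono)
    show "\<forall>\<^sub>F n in sequentially. ereal (root n (B ^ n * W n)) \<le> ereal (B * root n C)"
      using eventually_gt_at_top[of 0]
      by eventually_elim (use assms(1,2) in \<open>simp add: root_eq mult_left_mono\<close>)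
  qed
  also have "\<dots> = ereal B"
    using lim[OF \<open>C > 0\<close>] by (intro lim_imp_Limsup) auto
  finally show "limsup (\<lambda>n. ereal (root n (B ^ n * W n))) \<le> ereal B" .
  show "ereal B \<le> limsup (\<lambda>n. ereal (root n (B ^ n * W n)))"
  proof (rule ccontr)
    assume "\<not> ?thesis"
    then obtain y where y: "limsup (\<lambda>n. ereal (root n (B ^ n * W n))) < y" "y < ereal B"
      by (meson dense not_le)
    \<comment> \<open>All conditions except \<open>c \<le> W n\<close> hold eventually, so some
      single \<open>n\<close> meets them all and gives the contradiction.\<close>
    have "\<exists>\<^sub>F n in sequentially. c \<le> W n \<and>
        ereal (root n (B ^ n * W n)) < y \<and> y < ereal (B * root n c) \<and> n > 0"
      by (intro frequently_eventually_frequently[OF assms(4)] eventually_conj Limsup_lessD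
          order_tendstoD(1)[OF lim[OF assms(3)]] eventually_gt_at_top y)
    then obtain n where n: "c \<le> W n" "ereal (root n (B ^ n * W n)) < y"
        "y < ereal (B * root n c)" "n > 0"
      by (auto dest!: frequently_ex)
    have "B * root n c \<le> root n (B ^ n * W n)"
      using assms(1) n(1,4) by (simp add: root_eq mult_left_mono)
    moreover have "root n (B ^ n * W n) < B * root n c"
      using less_trans[OF n(2,3)] by simp
    ultimately show False by linarith
  qed
qed

text \<open>A fixed \<open>j\<close> is paired with the d - j values of \<open>k\<close> above
  it.\<close>

lemma prod_triangle_const_power:
  fixes f :: "nat \<Rightarrow> 'a::comm_monoid_mult"
  shows "(\<Prod>k=1..d. \<Prod>j=1..<k. f j ^ m) = (\<Prod>j=1..d. f j ^ (m * (d - j)))"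
proof (induction d)
  case (Suc d)
  have "(\<Prod>j=1..d. f j ^ (m * (Suc d - j))) = (\<Prod>j=1..d. f j ^ (m * (d - j)) * f j ^ m)"
    by (intro prod.cong refl) (simp add: Suc_diff_le add.commute flip: power_add)
  with Suc show ?case
    by (simp add: prod.distrib atLeastLessThanSuc_atLeastAtMost)
qed simp

text \<open>Two indices with the same root would put the square of a linear factor into the product,
  giving a root of order at least 2.\<close>

lemma rsquarefree_prod_linear_inj_on:
  fixes r :: "'b \<Rightarrow> 'a::idom"
  assumes "finite A" "rsquarefree (\<Prod>j\<in>A. [:- r j, 1:])"
  shows "inj_on r A"
proof (rule inj_onI, rule ccontr)
  fix i j assume ij: "i \<in> A" "j \<in> A" "r i = r j" "i \<noteq> j"
  let ?p = "\<Prod>j\<in>A. [:- r j, 1:]"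
  have "?p = [:- r i, 1:] * ([:- r j, 1:] * (\<Prod>j\<in>A - {i} - {j}. [:- r j, 1:]))"
    using assms(1) ij by (simp add: prod.remove[of A i] prod.remove[of "A - {i}" j])
  also have "\<dots> = [:- r i, 1:] ^ 2 * (\<Prod>j\<in>A - {i} - {j}. [:- r j, 1:])"
    by (simp only: ij(3) power2_eq_square mult.assoc)
  finally have "[:- r i, 1:] ^ 2 dvd ?p" by (metis dvd_triv_left)
  with assms(2) have "2 \<le> order (r i) ?p"
    by (simp add: order_divides rsquarefree_def)
  moreover have "order (r i) ?p \<le> 1"
    using assms(2) unfolding rsquarefree_def by (metis le_numeral_extra(4) zero_le)
  ultimately show False by linarith
qed

theorem theorem6p6:
  fixes P :: "int poly" and d :: nat and \<alpha> :: "nat \<Rightarrow> complex"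
  assumes "lead_coeff P = 1" and "degree P = d"
    and "rsquarefree (map_poly of_int P :: complex poly)"
    and "map_poly of_int P = (\<Prod>j=1..d. [:- \<alpha> j, 1:])"
    and "\<And>i j. 1 \<le> i \<Longrightarrow> i \<le> j \<Longrightarrow> j \<le> d \<Longrightarrow> cmod (\<alpha> j) \<le> cmod (\<alpha> i)"
  shows "limsup (\<lambda>n. ereal (root n (cmod (discriminant (power_poly d \<alpha> n)))))
           = ereal (\<Prod>j=1..d. cmod (\<alpha> j) ^ (2 * (d - j)))"
proof -
  have inj: "inj_on \<alpha> {1..d}"
    using assms(3,4) by (intro rsquarefree_prod_linear_inj_on) simp_all
  have nonzero: "\<alpha> j \<noteq> 0" and neq: "\<alpha> k \<noteq> \<alpha> j" and le: "cmod (\<alpha> k) \<le> cmod (\<alpha> j)"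
    if "k \<in> {1..d}" "j \<in> {1..<k}" for j k
  proof -
    show neq: "\<alpha> k \<noteq> \<alpha> j"
      using inj_onD[OF inj, of k j] that by auto
    show le: "cmod (\<alpha> k) \<le> cmod (\<alpha> j)"
      using assms(5)[of j k] that by auto
    \<comment> \<open>If \<alpha> j were 0, the ordering would force \<alpha> k = 0 as well, against
      distinctness. So only the last root can vanish, and it is never a denominator below.\<close>
    show "\<alpha> j \<noteq> 0"
      using neq le by auto
  qed
  define W where "W n = (\<Prod>k=1..d. \<Prod>j=1..<k. (cmod (1 - (\<alpha> k / \<alpha> j) ^ n))\<^sup>2)" for n
  \<comment> \<open>The claimed limsup, kept in the triangular shape of the discriminant until
    \<open>prod_triangle_const_power\<close> is applied at the end.\<close>
  define B where "B = (\<Prod>k=1..d. \<Prod>j=1..<k. (cmod (\<alpha> j))\<^sup>2)"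
  have disc: "cmod (discriminant (power_poly d \<alpha> n)) = B ^ n * W n" for n
  proof -
    have "cmod (discriminant (power_poly d \<alpha> n)) =
        (\<Prod>k=1..d. \<Prod>j=1..<k. ((cmod (\<alpha> j))\<^sup>2) ^ n * (cmod (1 - (\<alpha> k / \<alpha> j) ^ n))\<^sup>2)"
      unfolding discriminant_power_poly prod_norm[symmetric]
    proof (intro prod.cong refl)
      fix j k assume "k \<in> {1..d}" "j \<in> {1..<k}"
      then have "\<alpha> j ^ n - \<alpha> k ^ n = \<alpha> j ^ n * (1 - (\<alpha> k / \<alpha> j) ^ n)"
        using nonzero[of k j] by (simp add: field_simps)
      then show "cmod ((\<alpha> j ^ n - \<alpha> k ^ n)\<^sup>2) = ((cmod (\<alpha> j))\<^sup>2) ^ n * (cmod (1 - (\<alpha> k / \<alpha> j) ^ n))\<^sup>2"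
        by (simp add: norm_mult norm_power power_mult_distrib mult.commute flip: power_mult)
    qed
    then show ?thesis
      by (simp add: B_def W_def prod.distrib prod_power_distrib)
  qed
  have quot: "cmod (\<alpha> k / \<alpha> j) \<le> 1" "\<alpha> k / \<alpha> j \<noteq> 1" if "k \<in> {1..d}" "j \<in> {1..<k}" for j k
    using nonzero[OF that] neq[OF that] le[OF that] by (simp_all add: norm_divide)
  have W_le: "W n \<le> (\<Prod>k=1..d. \<Prod>j=1..<k. 2\<^sup>2)" for n
    unfolding W_def
  proof (intro prod_mono conjI prod_nonneg ballI power_mono)
    fix j k assume "k \<in> {1..d}" "j \<in> {1..<k}"
    from quot(1)[OF this] have "cmod ((\<alpha> k / \<alpha> j) ^ n) \<le> 1"
      unfolding norm_power by (intro power_le_one) auto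
    then show "cmod (1 - (\<alpha> k / \<alpha> j) ^ n) \<le> 2"
      using norm_triangle_ineq4[of 1 "(\<alpha> k / \<alpha> j) ^ n"] by simp
  qed auto
  \<comment> \<open>All quotients are collected in one set so that a single exponent serves every
    factor of \<open>W n\<close> at once.\<close>
  define Z where "Z = (\<Union>k\<in>{1..d}. (\<lambda>j. \<alpha> k / \<alpha> j) ` {1..<k})"
  have "finite Z" "\<And>z. z \<in> Z \<Longrightarrow> cmod z \<le> 1" "1 \<notin> Z"
    unfolding Z_def using quot by (simp, blast, force)
  from simultaneous_powers_away_from_1[OF this]
  obtain c where c: "c > 0" "\<exists>\<^sub>F n in sequentially. \<forall>z\<in>Z. c \<le> cmod (1 - z ^ n)"
    by blast
  have W_ge: "\<exists>\<^sub>F n in sequentially. (\<Prod>k=1..d. \<Prod>j=1..<k. c\<^sup>2) \<le> W n"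
    using c(2)
  proof (rule frequently_elim1)
    fix n assume "\<forall>z\<in>Z. c \<le> cmod (1 - z ^ n)"
    then show "(\<Prod>k=1..d. \<Prod>j=1..<k. c\<^sup>2) \<le> W n"
      unfolding W_def using c(1)
      by (intro prod_mono conjI prod_nonneg ballI power_mono) (auto simp: Z_def)
  qed
  have "limsup (\<lambda>n. ereal (root n (B ^ n * W n))) = ereal B"
    using c(1) by (intro limsup_root_power_times[OF _ W_le _ W_ge])
      (auto simp: B_def intro!: prod_nonneg prod_pos)
  then show ?thesis
    by (simp only: disc B_def prod_triangle_const_power)
qed

end
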